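(* Let $G$ and $H$ be groups with subgroups $A\le G$ and $B\le H$, let $\varphi: A\to B$ be an isomorphism, and let $\Gamma = G *_\varphi H$ be the free product of $G$ and $H$ with the subgroups $A$ and $B$ amalgamated with respect to $\varphi$. Let $G'\le G$ and $H'\le H$ be subgroups such that for $A'=G'\cap A$ and $B'=H'\cap B$ we have $\varphi(A')=B'$. Let $\Gamma'=\langle G',H'\rangle$ be the subgroup of $\Gamma$ generated by $G'$ and $H'$, and let $\varphi':A'\to B'$ be the restriction of $\varphi$ to $A'$. Then: (1) $\Gamma' = G'*_{\varphi'} H'$; (2) $\Gamma'\cap A=A'$ and $\Gamma'\cap B=B'$; (3) $\Gamma'\cap G=G'$ and $\Gamma'\cap H=H'$.
   Context: For an isomorphism $\varphi:A\to B$ with $A\le G$, $B\le H$, the group $G*_\varphi H$ is $\langle G, H \mid a=\varphi(a)\text{ for all }a\in A\rangle$. The groups $G$ and $H$ are identified with their natural images in $G*_\varphi H$. The equality $\Gamma'=G'*_{\varphi'}H'$ means that the natural homomorphism from the amalgamated product $G'*_{\varphi'}H'$ to $\Gamma$, induced by the inclusions $G'\le G$, $H'\le H$, is injective with image $\Gamma'$. *)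

theory Defs
  imports "HOL-Algebra.Generated_Groups"
begin

section \<open>Amalgamated free products\<close>

text \<open>
  The group \<open>\<langle>G, H | a = \<phi>(a) for all a \<in> A\<rangle>\<close> is built from words over the disjoint union of the
  carriers of \<open>G\<close> and \<open>H\<close>. No formal inverses of letters are needed, because
  the multiplication tables of \<open>G\<close> and \<open>H\<close> already make each letter invertible.
  The amalgamated subgroup \<open>B\<close> of \<open>H\<close> is the image of \<open>A\<close> under \<open>\<phi>\<close>.
\<close>

inductive amalg_eq ::
  "('a, 'm) monoid_scheme \<Rightarrow> ('b, 'n) monoid_scheme \<Rightarrow> 'a set \<Rightarrow> ('a \<Rightarrow> 'b)
    \<Rightarrow> ('a + 'b) list \<Rightarrow> ('a + 'b) list \<Rightarrow> bool"
  for G H A \<phi> where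
  refl: "w \<in> lists (carrier G <+> carrier H) \<Longrightarrow> amalg_eq G H A \<phi> w w"
| sym: "amalg_eq G H A \<phi> u v \<Longrightarrow> amalg_eq G H A \<phi> v u"
| trans: "amalg_eq G H A \<phi> u v \<Longrightarrow> amalg_eq G H A \<phi> v w \<Longrightarrow> amalg_eq G H A \<phi> u w"
| append: "amalg_eq G H A \<phi> u v \<Longrightarrow> amalg_eq G H A \<phi> u' v' \<Longrightarrow> amalg_eq G H A \<phi> (u @ u') (v @ v')"
| one_left: "amalg_eq G H A \<phi> [Inl \<one>\<^bsub>G\<^esub>] []"
| one_right: "amalg_eq G H A \<phi> [Inr \<one>\<^bsub>H\<^esub>] []"
| mult_left: "x \<in> carrier G \<Longrightarrow> y \<in> carrier G
    \<Longrightarrow> amalg_eq G H A \<phi> [Inl x, Inl y] [Inl (x \<otimes>\<^bsub>G\<^esub> y)]"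
| mult_right: "x \<in> carrier H \<Longrightarrow> y \<in> carrier H
    \<Longrightarrow> amalg_eq G H A \<phi> [Inr x, Inr y] [Inr (x \<otimes>\<^bsub>H\<^esub> y)]"
| amalg: "a \<in> A \<Longrightarrow> amalg_eq G H A \<phi> [Inl a] [Inr (\<phi> a)]"

definition amalg_rel where
  "amalg_rel G H A \<phi> = {(u, v). amalg_eq G H A \<phi> u v}"

definition amalg_product ::
  "('a, 'm) monoid_scheme \<Rightarrow> ('b, 'n) monoid_scheme \<Rightarrow> 'a set \<Rightarrow> ('a \<Rightarrow> 'b)
    \<Rightarrow> ('a + 'b) list set monoid" where
  "amalg_product G H A \<phi> =
    \<lparr>carrier = lists (carrier G <+> carrier H) // amalg_rel G H A \<phi>,
     mult = (\<lambda>X Y. \<Union>u\<in>X. \<Union>v\<in>Y. amalg_rel G H A \<phi> `` {u @ v}),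
     one = amalg_rel G H A \<phi> `` {[]}\<rparr>"

text \<open>The natural maps of \<open>G\<close> and \<open>H\<close> into the amalgamated product; subgroups of \<open>G\<close> and \<open>H\<close>
  are identified with their images under these maps.\<close>

definition amalg_inl where
  "amalg_inl G H A \<phi> x = amalg_rel G H A \<phi> `` {[Inl x]}"

definition amalg_inr where
  "amalg_inr G H A \<phi> y = amalg_rel G H A \<phi> `` {[Inr y]}"

definition word_eval ::
  "('k, 'p) monoid_scheme \<Rightarrow> ('a \<Rightarrow> 'k) \<Rightarrow> ('b \<Rightarrow> 'k) \<Rightarrow> ('a + 'b) list \<Rightarrow> 'k" where
  "word_eval K f g w = foldr (\<lambda>s k. case_sum f g s \<otimes>\<^bsub>K\<^esub> k) w \<one>\<^bsub>K\<^esub>"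

text \<open>
  The homomorphism induced on an amalgamated product by \<open>f\<close> and \<open>g\<close>: \<open>f\<close> and \<open>g\<close> agree on the
  amalgamated subgroup, so \<open>word_eval\<close> is constant on each equivalence class \<open>X\<close>
  (see \<open>lift_hom\<close>, \<open>lift_inl\<close>, \<open>lift_inr\<close> and \<open>lift_unique\<close> below).
\<close>

definition amalg_lift ::
  "('k, 'p) monoid_scheme \<Rightarrow> ('a \<Rightarrow> 'k) \<Rightarrow> ('b \<Rightarrow> 'k) \<Rightarrow> ('a + 'b) list set \<Rightarrow> 'k" where
  "amalg_lift K f g X = the_elem (word_eval K f g ` X)"


section \<open>Group structure and universal property\<close>

locale amalgam =
  fixes G :: "('a, 'm) monoid_scheme" and H :: "('b, 'n) monoid_scheme"
    and A :: "'a set" and \<phi> :: "'a \<Rightarrow> 'b"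
  assumes group_G: "group G" and group_H: "group H"
    and A_subset: "A \<subseteq> carrier G" and \<phi>_closed: "\<phi> ` A \<subseteq> carrier H"
begin

abbreviation "W \<equiv> lists (carrier G <+> carrier H)"
abbreviation "R \<equiv> amalg_rel G H A \<phi>"
abbreviation "P \<equiv> amalg_product G H A \<phi>"
abbreviation "inl \<equiv> amalg_inl G H A \<phi>"
abbreviation "inr \<equiv> amalg_inr G H A \<phi>"

lemma amalg_eq_words: "amalg_eq G H A \<phi> u v \<Longrightarrow> u \<in> W \<and> v \<in> W"
proof (induction rule: amalg_eq.induct)
  case one_left
  then show ?case using group.is_monoid[OF group_G] by (auto intro: monoid.one_closed)
next
  case one_right
  then show ?case using group.is_monoid[OF group_H] by (auto intro: monoid.one_closed)
next
  case (mult_left x y)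
  then show ?case using group.is_monoid[OF group_G] by (auto intro: monoid.m_closed)
next
  case (mult_right x y)
  then show ?case using group.is_monoid[OF group_H] by (auto intro: monoid.m_closed)
next
  case (amalg a)
  then show ?case using A_subset \<phi>_closed by auto
qed auto

lemma equiv_R: "equiv W R"
proof (rule equivI)
  show "R \<subseteq> W \<times> W"
    using amalg_eq_words by (auto simp only: amalg_rel_def mem_Collect_eq)
  show "refl_on W R"
    by (rule refl_onI) (simp only: amalg_rel_def mem_Collect_eq case_prod_conv amalg_eq.refl)
  show "sym R" by (auto simp: amalg_rel_def intro!: symI intro: amalg_eq.sym)
  show "trans R" by (auto simp: amalg_rel_def intro!: transI intro: amalg_eq.trans)
qed

lemma class_eqI: "amalg_eq G H A \<phi> u v \<Longrightarrow> R `` {u} = R `` {v}"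
  by (rule equiv_class_eq[OF equiv_R]) (simp add: amalg_rel_def)

lemma carrier_P: "carrier P = W // R"
  by (simp add: amalg_product_def)

lemma one_P: "\<one>\<^bsub>P\<^esub> = R `` {[]}"
  by (simp add: amalg_product_def)

lemma class_in_P: "w \<in> W \<Longrightarrow> R `` {w} \<in> carrier P"
  by (simp only: carrier_P quotientI)

lemma mult_P:
  assumes "u \<in> W" "v \<in> W"
  shows "R `` {u} \<otimes>\<^bsub>P\<^esub> R `` {v} = R `` {u @ v}"
proof -
  have "R `` {u' @ v'} = R `` {u @ v}" if "u' \<in> R `` {u}" "v' \<in> R `` {v}" for u' v'
    using that by (intro class_eqI) (auto simp: amalg_rel_def intro: amalg_eq.sym amalg_eq.append)
  moreover have "u \<in> R `` {u}" "v \<in> R `` {v}"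
    using assms equiv_class_self[OF equiv_R] by blast+
  ultimately show ?thesis
    unfolding amalg_product_def monoid.simps by blast
qed

lemma carrier_P_cases:
  assumes "X \<in> carrier P"
  obtains w where "w \<in> W" "X = R `` {w}"
  using assms that unfolding carrier_P by (elim quotientE) blast

lemma word_left_inverse:
  "w \<in> W \<Longrightarrow> \<exists>v\<in>W. amalg_eq G H A \<phi> (v @ w) []"
proof (induction w)
  case Nil
  show ?case by (intro bexI[of _ "[]"]) (auto intro: amalg_eq.refl)
next
  case (Cons s w)
  then obtain v where v: "v \<in> W" "amalg_eq G H A \<phi> (v @ w) []" by auto
  have w: "w \<in> W" and s: "s \<in> carrier G <+> carrier H" using Cons.prems by auto
  obtain t where t: "t \<in> carrier G <+> carrier H" "amalg_eq G H A \<phi> [t, s] []"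
  proof (cases s)
    case (Inl x)
    then have x: "x \<in> carrier G" using s by auto
    have "amalg_eq G H A \<phi> [Inl (inv\<^bsub>G\<^esub> x), Inl x] [Inl (inv\<^bsub>G\<^esub> x \<otimes>\<^bsub>G\<^esub> x)]"
      using x group_G by (intro amalg_eq.mult_left) auto
    then have "amalg_eq G H A \<phi> [Inl (inv\<^bsub>G\<^esub> x), Inl x] []"
      using x group_G amalg_eq.one_left amalg_eq.trans by (metis group.l_inv)
    then show ?thesis using x group_G Inl by (intro that[of "Inl (inv\<^bsub>G\<^esub> x)"]) auto
  next
    case (Inr x)
    then have x: "x \<in> carrier H" using s by auto
    have "amalg_eq G H A \<phi> [Inr (inv\<^bsub>H\<^esub> x), Inr x] [Inr (inv\<^bsub>H\<^esub> x \<otimes>\<^bsub>H\<^esub> x)]"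
      using x group_H by (intro amalg_eq.mult_right) auto
    then have "amalg_eq G H A \<phi> [Inr (inv\<^bsub>H\<^esub> x), Inr x] []"
      using x group_H amalg_eq.one_right amalg_eq.trans by (metis group.l_inv)
    then show ?thesis using x group_H Inr by (intro that[of "Inr (inv\<^bsub>H\<^esub> x)"]) auto
  qed
  have "amalg_eq G H A \<phi> ([t, s] @ w) ([] @ w)"
    by (rule amalg_eq.append[OF t(2) amalg_eq.refl[OF w]])
  from amalg_eq.append[OF amalg_eq.refl[OF v(1)] this]
  have "amalg_eq G H A \<phi> ((v @ [t]) @ s # w) (v @ w)" by simp
  then have "amalg_eq G H A \<phi> ((v @ [t]) @ s # w) []"
    using v(2) amalg_eq.trans by blast
  moreover have "v @ [t] \<in> W" using v(1) t(1) by auto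
  ultimately show ?case by blast
qed

lemma group_P: "group P"
proof (rule groupI)
  fix X Y assume "X \<in> carrier P" "Y \<in> carrier P"
  then obtain u v where *: "u \<in> W" "X = R `` {u}" "v \<in> W" "Y = R `` {v}"
    by (metis carrier_P_cases)
  then show "X \<otimes>\<^bsub>P\<^esub> Y \<in> carrier P"
    using mult_P[OF *(1,3)] class_in_P[of "u @ v"] by auto
next
  show "\<one>\<^bsub>P\<^esub> \<in> carrier P" unfolding one_P by (rule class_in_P) simp
next
  fix X Y Z assume "X \<in> carrier P" "Y \<in> carrier P" "Z \<in> carrier P"
  then obtain u v w where *: "u \<in> W" "v \<in> W" "w \<in> W"
      and **: "X = R `` {u}" "Y = R `` {v}" "Z = R `` {w}"
    by (metis carrier_P_cases)
  have "u @ v \<in> W" "v @ w \<in> W" using * by auto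
  then show "X \<otimes>\<^bsub>P\<^esub> Y \<otimes>\<^bsub>P\<^esub> Z = X \<otimes>\<^bsub>P\<^esub> (Y \<otimes>\<^bsub>P\<^esub> Z)"
    unfolding ** using * by (simp only: mult_P append_assoc)
next
  fix X assume "X \<in> carrier P"
  then obtain u where u: "u \<in> W" "X = R `` {u}" by (metis carrier_P_cases)
  show "\<one>\<^bsub>P\<^esub> \<otimes>\<^bsub>P\<^esub> X = X"
    unfolding one_P u(2) using u(1) by (simp only: mult_P lists.Nil append_Nil)
  obtain v where v: "v \<in> W" "amalg_eq G H A \<phi> (v @ u) []"
    using word_left_inverse[OF u(1)] by blast
  have "R `` {v} \<otimes>\<^bsub>P\<^esub> X = \<one>\<^bsub>P\<^esub>"
    unfolding u(2) mult_P[OF v(1) u(1)] one_P by (rule class_eqI[OF v(2)])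
  then show "\<exists>Y\<in>carrier P. Y \<otimes>\<^bsub>P\<^esub> X = \<one>\<^bsub>P\<^esub>"
    using class_in_P[OF v(1)] by blast
qed

lemma inl_hom: "inl \<in> hom G P"
proof (rule homI)
  fix x assume "x \<in> carrier G"
  then show "inl x \<in> carrier P" unfolding amalg_inl_def by (intro class_in_P) auto
next
  fix x y assume *: "x \<in> carrier G" "y \<in> carrier G"
  have "inl x \<otimes>\<^bsub>P\<^esub> inl y = R `` {[Inl x] @ [Inl y]}"
    unfolding amalg_inl_def using * by (intro mult_P) auto
  also have "\<dots> = inl (x \<otimes>\<^bsub>G\<^esub> y)"
    unfolding amalg_inl_def using amalg_eq.mult_left[OF *] by (intro class_eqI) simp
  finally show "inl (x \<otimes>\<^bsub>G\<^esub> y) = inl x \<otimes>\<^bsub>P\<^esub> inl y" by simp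
qed

lemma inr_hom: "inr \<in> hom H P"
proof (rule homI)
  fix x assume "x \<in> carrier H"
  then show "inr x \<in> carrier P" unfolding amalg_inr_def by (intro class_in_P) auto
next
  fix x y assume *: "x \<in> carrier H" "y \<in> carrier H"
  have "inr x \<otimes>\<^bsub>P\<^esub> inr y = R `` {[Inr x] @ [Inr y]}"
    unfolding amalg_inr_def using * by (intro mult_P) auto
  also have "\<dots> = inr (x \<otimes>\<^bsub>H\<^esub> y)"
    unfolding amalg_inr_def using amalg_eq.mult_right[OF *] by (intro class_eqI) simp
  finally show "inr (x \<otimes>\<^bsub>H\<^esub> y) = inr x \<otimes>\<^bsub>P\<^esub> inr y" by simp
qed

lemma inl_eq_inr: "a \<in> A \<Longrightarrow> inl a = inr (\<phi> a)"
  unfolding amalg_inl_def amalg_inr_def by (intro class_eqI amalg_eq.amalg)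

context
  fixes K :: "('k, 'p) monoid_scheme" and f :: "'a \<Rightarrow> 'k" and g :: "'b \<Rightarrow> 'k"
  assumes group_K: "group K" and f: "f \<in> hom G K" and g: "g \<in> hom H K"
    and agree: "\<And>a. a \<in> A \<Longrightarrow> f a = g (\<phi> a)"
begin

interpretation K: group K by (rule group_K)

lemma letter_closed: "s \<in> carrier G <+> carrier H \<Longrightarrow> case_sum f g s \<in> carrier K"
  using f g by (auto simp: hom_def)

lemma word_eval_closed: "w \<in> W \<Longrightarrow> word_eval K f g w \<in> carrier K"
  by (induction w) (auto simp: word_eval_def letter_closed )

lemma word_eval_append:
  "u \<in> W \<Longrightarrow> v \<in> W \<Longrightarrow> word_eval K f g (u @ v) = word_eval K f g u \<otimes>\<^bsub>K\<^esub> word_eval K f g v"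
proof (induction u)
  case Nil
  then show ?case using word_eval_closed[of v] by (simp add: word_eval_def)
next
  case (Cons s u)
  have "u \<in> W" "s \<in> carrier G <+> carrier H" using Cons.prems by auto
  with Cons letter_closed[of s] word_eval_closed[of u] word_eval_closed[of v]
  show ?case by (simp add: word_eval_def K.m_assoc)
qed

lemma word_eval_eq: "amalg_eq G H A \<phi> u v \<Longrightarrow> word_eval K f g u = word_eval K f g v"
proof (induction rule: amalg_eq.induct)
  case (append u v u' v')
  then show ?case using amalg_eq_words word_eval_append by metis
next
  case one_left
  then show ?case using hom_one[OF f group_G group_K] by (simp add: word_eval_def)
next
  case one_right
  then show ?case using hom_one[OF g group_H group_K] by (simp add: word_eval_def)
next
  case (mult_left x y)
  then show ?case using f group_G by (auto simp: word_eval_def hom_def Pi_def K.m_assoc)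
next
  case (mult_right x y)
  then show ?case using g group_H by (auto simp: word_eval_def hom_def Pi_def K.m_assoc)
next
  case (amalg a)
  then show ?case by (simp add: word_eval_def agree)
qed auto

lemma lift_class:
  assumes "w \<in> W"
  shows "amalg_lift K f g (R `` {w}) = word_eval K f g w"
proof -
  have "w \<in> R `` {w}" using equiv_class_self[OF equiv_R assms] .
  moreover have "word_eval K f g v = word_eval K f g w" if "v \<in> R `` {w}" for v
    using that word_eval_eq[of w v] by (simp add: amalg_rel_def)
  ultimately have "word_eval K f g ` (R `` {w}) = {word_eval K f g w}" by blast
  then show ?thesis by (simp add: amalg_lift_def)
qed

lemma lift_hom: "amalg_lift K f g \<in> hom P K"
proof (rule homI)
  fix X assume "X \<in> carrier P"
  then obtain u where "u \<in> W" "X = R `` {u}" by (metis carrier_P_cases)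
  then show "amalg_lift K f g X \<in> carrier K" using lift_class word_eval_closed by metis
next
  fix X Y assume "X \<in> carrier P" "Y \<in> carrier P"
  then obtain u v where *: "u \<in> W" "v \<in> W" and **: "X = R `` {u}" "Y = R `` {v}"
    by (metis carrier_P_cases)
  have "u @ v \<in> W" using * by auto
  then show "amalg_lift K f g (X \<otimes>\<^bsub>P\<^esub> Y) = amalg_lift K f g X \<otimes>\<^bsub>K\<^esub> amalg_lift K f g Y"
    unfolding ** using * by (simp only: mult_P lift_class word_eval_append)
qed

lemma lift_inl: "x \<in> carrier G \<Longrightarrow> amalg_lift K f g (inl x) = f x"
  using lift_class[of "[Inl x]"] f by (simp add: InlI amalg_inl_def word_eval_def hom_def Pi_def)

lemma lift_inr: "y \<in> carrier H \<Longrightarrow> amalg_lift K f g (inr y) = g y"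
  using lift_class[of "[Inr y]"] g by (simp add: InrI amalg_inr_def word_eval_def hom_def Pi_def)

lemma lift_unique:
  assumes h: "h \<in> hom P K"
    and hl: "\<And>x. x \<in> carrier G \<Longrightarrow> h (inl x) = f x"
    and hr: "\<And>y. y \<in> carrier H \<Longrightarrow> h (inr y) = g y"
    and X: "X \<in> carrier P"
  shows "h X = amalg_lift K f g X"
proof -
  have "w \<in> W \<Longrightarrow> h (R `` {w}) = word_eval K f g w" for w
  proof (induction w)
    case Nil
    then show ?case using hom_one[OF h group_P group_K] by (simp add: word_eval_def one_P)
  next
    case (Cons s w)
    have w: "w \<in> W" and s: "[s] \<in> W" using Cons.prems by auto
    have "h (R `` {[s]}) = case_sum f g s"
      using s hl hr by (cases s) (auto simp: amalg_inl_def amalg_inr_def)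
    moreover have "h (R `` {s # w}) = h (R `` {[s]}) \<otimes>\<^bsub>K\<^esub> h (R `` {w})"
      using hom_mult[OF h class_in_P[OF s] class_in_P[OF w]] mult_P[OF s w] by simp
    ultimately show ?case using Cons.IH[OF w] by (simp add: word_eval_def)
  qed
  with X show ?thesis by (metis carrier_P_cases lift_class)
qed

end

end

end

theory Submission
  imports Defs
begin

text \<open>
  The proof is van der Waerden's normal form argument, with coset representatives adapted to
  the subgroups \<open>G'\<close> and \<open>H'\<close>. Choose a representative of each right coset \<open>A x\<close> in \<open>G\<close> and
  \<open>B y\<close> in \<open>H\<close>, the identity for the cosets \<open>A\<close> and \<open>B\<close>, and an element of \<open>G'\<close> (of \<open>H'\<close>)
  whenever the coset contains one. A normal form is a pair \<open>(a, l)\<close> with \<open>a \<in> A\<close> and \<open>l\<close> a list of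
  nontrivial representatives, alternately from \<open>G\<close> and from \<open>H\<close>. The set of normal forms is in
  bijection with \<open>G \<times> L\<close>, where \<open>L\<close> consists of the alternating lists not starting in \<open>G\<close>, so
  \<open>G\<close> acts on it by left multiplication on the first component; likewise \<open>H\<close> acts, and the two
  actions agree on the amalgamated subgroup. Hence words act on normal forms through \<open>\<Gamma>\<close>
  (\<open>word_act_cong\<close>), and applying a word to \<open>(\<one>, [])\<close> gives a normal form that depends
  only on the element of \<open>\<Gamma>\<close> (\<open>normal_form_cong\<close>).

  Two facts about words over \<open>G'\<close> and \<open>H'\<close> now suffice. By the choice of representatives, their
  normal forms \<open>(a, l)\<close> have \<open>a \<in> A'\<close> and all letters of \<open>l\<close> in \<open>G'\<close> or \<open>H'\<close>
  (\<open>normal_form_sub\<close>): if \<open>x = a t\<close> with \<open>x\<close> and \<open>t\<close> in \<open>G'\<close>, then \<open>a \<in> G' \<inter> A\<close>. And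
  the normal form, read as a word over \<open>G'\<close> and \<open>H'\<close>, represents the same element
  of \<open>G' *\<^bsub>\<phi>'\<^esub> H'\<close> as the given word (\<open>form_value_normal_form\<close>), because each step of the
  action only uses relations of that group. Consequently two such words that are
  equal in \<open>\<Gamma>\<close> have the same normal form and are already equal in \<open>G' *\<^bsub>\<phi>'\<^esub> H'\<close>, which is (1).
  For (3), the normal form of a single letter \<open>x = a t\<close> of \<open>G\<close> is \<open>a\<close> followed by \<open>t\<close>,
  which is left out if it is \<open>\<one>\<close>; if \<open>x\<close> represents an element of \<open>\<Gamma>'\<close>, then \<open>a\<close> and \<open>t\<close> lie in \<open>G'\<close>, hence so does \<open>x\<close>. Finally, (2)
  follows from (3) by intersecting with \<open>A\<close> and \<open>B\<close>.
\<close>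

section \<open>Coset representatives adapted to a subgroup\<close>

text \<open>
  One factor \<open>K\<close> of an amalgam: the amalgamated group \<open>M\<close> is embedded into \<open>K\<close> by \<open>e\<close>,
  the subgroup \<open>U\<close> plays the part of \<open>G'\<close> or \<open>H'\<close>, and \<open>c\<close> turns elements of \<open>K\<close> into letters.
  The two instances are \<open>K = G\<close>, \<open>e = id\<close>, \<open>c = Inl\<close> and \<open>K = H\<close>, \<open>e = \<phi>\<close>, \<open>c = Inr\<close>, both
  with \<open>M = A\<close>, so that each statement about a factor has to be proved only once.
\<close>

locale amalgam_factor = group K for K :: "('k, 'q) monoid_scheme" (structure) +
  fixes M :: "('a, 'm) monoid_scheme" and e :: "'a \<Rightarrow> 'k" and U :: "'k set" and c :: "'k \<Rightarrow> 's"
  assumes M: "group M" and e_hom: "e \<in> hom M K" and e_inj: "inj_on e (carrier M)"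
    and U: "subgroup U K" and c_inj: "inj c"
begin

abbreviation E where "E \<equiv> e ` carrier M"

lemma E_subgroup: "subgroup E K"
proof -
  interpret group_hom M K e
    using M e_hom is_group by (simp add: group_hom_def group_hom_axioms_def)
  show ?thesis by (rule img_is_subgroup)
qed

lemma e_closed [simp]: "a \<in> carrier M \<Longrightarrow> e a \<in> carrier K"
  using e_hom by (auto simp: hom_def)

lemma e_mult: "a \<in> carrier M \<Longrightarrow> b \<in> carrier M \<Longrightarrow> e (a \<otimes>\<^bsub>M\<^esub> b) = e a \<otimes> e b"
  using e_hom by (auto simp: hom_def)

lemma e_one: "e \<one>\<^bsub>M\<^esub> = \<one>"
  using hom_one[OF e_hom M is_group] .

lemma U_closed: "x \<in> U \<Longrightarrow> x \<in> carrier K"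
  using subgroup.mem_carrier[OF U] .

text \<open>
  The conditions on the representative are compatible because \<open>\<one> \<in> U\<close>. All of them refer to
  the coset alone, which makes \<open>rep\<close> constant on cosets.
\<close>

definition rep :: "'k \<Rightarrow> 'k" where
  "rep x = (SOME y. y \<in> E #> x \<and> (\<one> \<in> E #> x \<longrightarrow> y = \<one>) \<and> ((E #> x) \<inter> U \<noteq> {} \<longrightarrow> y \<in> U))"

lemma rep_props:
  assumes "x \<in> carrier K"
  shows "rep x \<in> E #> x" "\<one> \<in> E #> x \<Longrightarrow> rep x = \<one>" "x \<in> U \<Longrightarrow> rep x \<in> U"
proof -
  have x: "x \<in> E #> x"
    using assms E_subgroup by (rule rcos_self)
  have "\<exists>y. y \<in> E #> x \<and> (\<one> \<in> E #> x \<longrightarrow> y = \<one>) \<and> ((E #> x) \<inter> U \<noteq> {} \<longrightarrow> y \<in> U)"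
    using x subgroup.one_closed[OF U] by (cases "\<one> \<in> E #> x") blast+
  from someI_ex[OF this]
  have *: "rep x \<in> E #> x \<and> (\<one> \<in> E #> x \<longrightarrow> rep x = \<one>) \<and> ((E #> x) \<inter> U \<noteq> {} \<longrightarrow> rep x \<in> U)"
    unfolding rep_def .
  then show "rep x \<in> E #> x" "\<one> \<in> E #> x \<Longrightarrow> rep x = \<one>" by blast+
  show "x \<in> U \<Longrightarrow> rep x \<in> U" using * x by blast
qed

lemma rep_closed [simp]: "x \<in> carrier K \<Longrightarrow> rep x \<in> carrier K"
  using rep_props(1) E_subgroup by (meson r_coset_subset_G subgroup.subset subsetD)

lemma rep_cong: "y \<in> E #> x \<Longrightarrow> x \<in> carrier K \<Longrightarrow> rep y = rep x"
  using repr_independence[OF _ _ E_subgroup, of y x] unfolding rep_def by simp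

lemma rep_rep: "x \<in> carrier K \<Longrightarrow> rep (rep x) = rep x"
  using rep_cong[OF rep_props(1)] .

lemma rep_mult: "a \<in> carrier M \<Longrightarrow> x \<in> carrier K \<Longrightarrow> rep (e a \<otimes> x) = rep x"
  by (rule rep_cong) (auto simp: r_coset_def)

lemma rep_embed: "a \<in> carrier M \<Longrightarrow> rep (e a) = \<one>"
  using rep_props(2)[of \<one>] rep_mult[of a \<one>] rcos_self[OF one_closed E_subgroup] by simp

text \<open>The component \<open>a\<close> in the unique factorisation \<open>x = e a \<otimes> rep x\<close>.\<close>

definition coord :: "'k \<Rightarrow> 'a" where
  "coord x = inv_into (carrier M) e (x \<otimes> inv (rep x))"

lemma coord:
  assumes x: "x \<in> carrier K"
  shows "coord x \<in> carrier M" "e (coord x) \<otimes> rep x = x"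
proof -
  obtain a where a: "a \<in> carrier M" "rep x = e a \<otimes> x"
    using rep_props(1)[OF x] by (auto simp: r_coset_def)
  have "x \<otimes> inv (rep x) = inv (e a)"
    using a x by (simp add: inv_mult_group m_assoc[symmetric])
  then have *: "x \<otimes> inv (rep x) \<in> E"
    using a(1) subgroup.m_inv_closed[OF E_subgroup] by auto
  show "coord x \<in> carrier M"
    unfolding coord_def by (rule inv_into_into[OF *])
  show "e (coord x) \<otimes> rep x = x"
    unfolding coord_def f_inv_into_f[OF *] using x by (simp add: m_assoc)
qed

lemma coord_eqI:
  assumes "a \<in> carrier M" "x \<in> carrier K" "x = e a \<otimes> rep x"
  shows "coord x = a"
proof -
  have "e (coord x) \<otimes> rep x = e a \<otimes> rep x"
    using coord(2)[OF assms(2)] assms(3) by simp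
  then have "e (coord x) = e a"
    using right_cancel[of "rep x" "e (coord x)" "e a"] assms(1,2) coord(1)[OF assms(2)] by simp
  then show ?thesis using e_inj assms(1) coord(1)[OF assms(2)] by (auto dest: inj_onD)
qed

lemma coord_mult:
  assumes "a \<in> carrier M" "x \<in> carrier K"
  shows "coord (e a \<otimes> x) = a \<otimes>\<^bsub>M\<^esub> coord x"
proof (rule coord_eqI)
  show "a \<otimes>\<^bsub>M\<^esub> coord x \<in> carrier M"
    using M assms coord(1) by (simp add: group.is_monoid monoid.m_closed)
  show "e a \<otimes> x = e (a \<otimes>\<^bsub>M\<^esub> coord x) \<otimes> rep (e a \<otimes> x)"
    using assms coord[OF assms(2)] by (simp add: rep_mult e_mult m_assoc)
qed (use assms in simp)

text \<open>
  This is where the choice of representatives inside \<open>U\<close> pays off: both factors of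
  \<open>x = e (coord x) \<otimes> rep x\<close> stay in \<open>U\<close> when \<open>x\<close> does.
\<close>

lemma coord_U:
  assumes "x \<in> U"
  shows "e (coord x) \<in> U"
proof -
  have x: "x \<in> carrier K" using assms by (rule U_closed)
  have "x \<otimes> inv (rep x) = e (coord x)"
    using coord[OF x] x by (metis e_closed inv_solve_right' rep_closed)
  moreover have "x \<otimes> inv (rep x) \<in> U"
    using assms rep_props(3)[OF x] U by (simp add: subgroup.m_closed subgroup.m_inv_closed)
  ultimately show ?thesis by simp
qed

section \<open>The action of one factor on normal forms\<close>

definition transversal :: "'k set" where
  "transversal = rep ` carrier K - {\<one>}"

lemma transversal_closed: "t \<in> transversal \<Longrightarrow> t \<in> carrier K"
  by (auto simp: transversal_def)

definition bare :: "'s list \<Rightarrow> bool" where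
  "bare l \<longleftrightarrow> (\<forall>t l'. l \<noteq> c t # l')"

text \<open>
  A pair \<open>(a, l)\<close> stands for the product of \<open>a\<close> with the letters of \<open>l\<close>. The maps \<open>peel\<close> and
  \<open>glue\<close> are the mutually inverse bijections between normal forms and pairs \<open>(x, l)\<close> with
  \<open>x \<in> carrier K\<close> and \<open>l\<close> not starting in \<open>K\<close>. The action is left multiplication transported
  along them.
\<close>

definition peel :: "'a \<times> 's list \<Rightarrow> 'k \<times> 's list" where
  "peel \<omega> = (if bare (snd \<omega>) then (e (fst \<omega>), snd \<omega>)
     else (e (fst \<omega>) \<otimes> inv_into UNIV c (hd (snd \<omega>)), tl (snd \<omega>)))"

definition glue :: "'k \<times> 's list \<Rightarrow> 'a \<times> 's list" where
  "glue = (\<lambda>(x, l). (coord x, if rep x = \<one> then l else c (rep x) # l))"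

definition act :: "'k \<Rightarrow> 'a \<times> 's list \<Rightarrow> 'a \<times> 's list" where
  "act x \<omega> = (case peel \<omega> of (y, l) \<Rightarrow> glue (x \<otimes> y, l))"

lemma peel_bare: "bare l \<Longrightarrow> peel (a, l) = (e a, l)"
  by (simp add: peel_def)

lemma peel_Cons: "peel (a, c t # l) = (e a \<otimes> t, l)"
  using c_inj by (auto simp: peel_def bare_def)

lemma bareE:
  obtains "bare l" | t l' where "l = c t # l'"
  by (auto simp: bare_def)

text \<open>
  The alternating lists involve the transversals of both factors; a single factor only needs
  to know which of them start with one of its own letters.
\<close>

context
  fixes N :: "'s list set"
  assumes N_Cons: "\<And>t l. c t # l \<in> N \<longleftrightarrow> t \<in> transversal \<and> bare l \<and> l \<in> N"
begin

lemma peel_in: "\<omega> \<in> carrier M \<times> N \<Longrightarrow> peel \<omega> \<in> carrier K \<times> {l \<in> N. bare l}"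
  by (cases \<omega>, rule bareE[of "snd \<omega>"])
    (auto simp: peel_bare peel_Cons N_Cons transversal_closed)

lemma glue_in: "p \<in> carrier K \<times> {l \<in> N. bare l} \<Longrightarrow> glue p \<in> carrier M \<times> N"
  by (auto simp: glue_def coord(1) N_Cons transversal_def)

lemma peel_glue: "p \<in> carrier K \<times> {l \<in> N. bare l} \<Longrightarrow> peel (glue p) = p"
  using coord(2)[of "fst p"] coord(1)[of "fst p"]
  by (cases p) (auto simp: glue_def peel_bare peel_Cons)

lemma glue_peel:
  assumes "\<omega> \<in> carrier M \<times> N"
  shows "glue (peel \<omega>) = \<omega>"
proof -
  obtain a l where \<omega>: "\<omega> = (a, l)" by force
  have a: "a \<in> carrier M" and l: "l \<in> N" using assms \<omega> by auto
  show ?thesis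
  proof (rule bareE[of l])
    assume "bare l"
    moreover have "coord (e a) = a"
      using a by (intro coord_eqI) (auto simp: rep_embed)
    ultimately show ?thesis using a by (simp add: \<omega> peel_bare glue_def rep_embed)
  next
    fix t l' assume l': "l = c t # l'"
    then have t: "t \<in> transversal" using l N_Cons by simp
    then have tK: "t \<in> carrier K" "t \<noteq> \<one>" "rep t = t"
      by (auto simp: transversal_def rep_rep)
    moreover have "coord (e a \<otimes> t) = a"
      using a tK by (intro coord_eqI) (auto simp: rep_mult)
    ultimately show ?thesis using a by (simp add: \<omega> l' peel_Cons glue_def rep_mult)
  qed
qed

lemma act_closed: "x \<in> carrier K \<Longrightarrow> \<omega> \<in> carrier M \<times> N \<Longrightarrow> act x \<omega> \<in> carrier M \<times> N"
  using peel_in[of \<omega>] by (auto simp: act_def split: prod.split intro!: glue_in)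

lemma act_one: "\<omega> \<in> carrier M \<times> N \<Longrightarrow> act \<one> \<omega> = \<omega>"
  using peel_in[of \<omega>] glue_peel[of \<omega>] by (auto simp: act_def split: prod.split)

lemma act_act:
  assumes "x \<in> carrier K" "y \<in> carrier K" "\<omega> \<in> carrier M \<times> N"
  shows "act x (act y \<omega>) = act (x \<otimes> y) \<omega>"
proof -
  obtain z l where zl: "peel \<omega> = (z, l)" by force
  then have "z \<in> carrier K" "l \<in> N" "bare l" using peel_in[OF assms(3)] by auto
  then show ?thesis using assms
    by (simp add: act_def zl peel_glue m_assoc)
qed

text \<open>
  On the amalgamated subgroup the action multiplies the first component and does not depend
  on the factor, so that the actions of the two factors agree there.
\<close>

lemma act_embed:
  assumes "a \<in> carrier M" "b \<in> carrier M" "l \<in> N"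
  shows "act (e a) (b, l) = (a \<otimes>\<^bsub>M\<^esub> b, l)"
proof -
  obtain z l' where zl: "peel (b, l) = (z, l')" by force
  then have z: "z \<in> carrier K" using peel_in[of "(b, l)"] assms by auto
  have "glue (z, l') = (b, l)" using glue_peel[of "(b, l)"] zl assms by simp
  then show ?thesis using assms z
    by (auto simp: act_def zl glue_def coord_mult rep_mult)
qed

text \<open>\<open>S\<close> stands for the letters from the subgroups of both factors.\<close>

context
  fixes S :: "'s set"
  assumes S: "\<And>t. c t \<in> S \<longleftrightarrow> t \<in> U"
begin

abbreviation sub_forms :: "('a \<times> 's list) set" where
  "sub_forms \<equiv> {a \<in> carrier M. e a \<in> U} \<times> (N \<inter> lists S)"

lemma peel_sub: "\<omega> \<in> sub_forms \<Longrightarrow> peel \<omega> \<in> U \<times> (N \<inter> lists S)"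
  by (cases \<omega>, rule bareE[of "snd \<omega>"])
    (auto simp: peel_bare peel_Cons N_Cons S intro: subgroup.m_closed[OF U])

lemma glue_sub: "(x, l) \<in> U \<times> (N \<inter> lists S) \<Longrightarrow> bare l \<Longrightarrow> glue (x, l) \<in> sub_forms"
  using glue_in[of "(x, l)"]
  by (auto simp: glue_def U_closed coord_U S rep_props(3))

lemma act_sub:
  assumes "x \<in> U" "\<omega> \<in> sub_forms"
  shows "act x \<omega> \<in> sub_forms"
proof -
  obtain z l where zl: "peel \<omega> = (z, l)" by force
  have "bare l" using peel_in[of \<omega>] assms zl by auto
  then show ?thesis
    using peel_sub[OF assms(2)] assms(1) zl unfolding act_def
    by (auto intro!: glue_sub subgroup.m_closed[OF U] simp del: mem_Sigma_iff)
qed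

text \<open>
  Let \<open>Q\<close> be any group to which \<open>U\<close> maps by \<open>\<nu>\<close> and in which words over \<open>S\<close> have a value. Neither
  peeling nor gluing changes the product represented by a normal form, since both only use
  the multiplication of \<open>U\<close>; so acting by \<open>x\<close> multiplies the value by \<open>\<nu> x\<close>.
\<close>

lemma value_act:
  fixes Q :: "('p, 'r) monoid_scheme"
  assumes Q: "group Q" and \<nu>: "\<nu> \<in> hom (K\<lparr>carrier := U\<rparr>) Q"
    and val: "\<And>l. l \<in> lists S \<Longrightarrow> val l \<in> carrier Q"
    and val_Cons: "\<And>t l. t \<in> U \<Longrightarrow> l \<in> lists S \<Longrightarrow> val (c t # l) = \<nu> t \<otimes>\<^bsub>Q\<^esub> val l"
    and x: "x \<in> U" and a: "a \<in> carrier M" "e a \<in> U" and l: "l \<in> N \<inter> lists S"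
  shows "\<nu> (e (fst (act x (a, l)))) \<otimes>\<^bsub>Q\<^esub> val (snd (act x (a, l))) = \<nu> x \<otimes>\<^bsub>Q\<^esub> (\<nu> (e a) \<otimes>\<^bsub>Q\<^esub> val l)"
proof -
  interpret Q: group Q by (rule Q)
  have \<nu>_closed [simp]: "\<nu> u \<in> carrier Q" if "u \<in> U" for u
    using \<nu> that by (auto simp: hom_def)
  have \<nu>_mult: "\<nu> (u \<otimes> v) = \<nu> u \<otimes>\<^bsub>Q\<^esub> \<nu> v" if "u \<in> U" "v \<in> U" for u v
    using \<nu> that by (auto simp: hom_def)
  have \<nu>_one: "\<nu> \<one> = \<one>\<^bsub>Q\<^esub>"
    using hom_one[OF \<nu> subgroup.subgroup_is_group[OF U is_group] Q] by simp
  obtain z m where zm: "peel (a, l) = (z, m)" by force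
  have z: "z \<in> U" "m \<in> lists S"
    using peel_sub[of "(a, l)"] a l zm by auto
  have peel_val: "\<nu> (e a) \<otimes>\<^bsub>Q\<^esub> val l = \<nu> z \<otimes>\<^bsub>Q\<^esub> val m"
  proof (rule bareE[of l])
    assume "bare l"
    then show ?thesis using zm by (simp add: peel_bare)
  next
    fix t l' assume l': "l = c t # l'"
    then have t: "t \<in> U" "l' \<in> lists S" using l S by auto
    have "z = e a \<otimes> t" "m = l'" using zm by (simp_all add: l' peel_Cons)
    then show ?thesis
      using val[OF t(2)] t a by (simp only: l' val_Cons \<nu>_mult Q.m_assoc \<nu>_closed)
  qed
  have glue_val: "\<nu> (e (fst (glue (u, m)))) \<otimes>\<^bsub>Q\<^esub> val (snd (glue (u, m))) = \<nu> u \<otimes>\<^bsub>Q\<^esub> val m"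
    if u: "u \<in> U" for u
  proof -
    have r: "rep u \<in> U" and k: "e (coord u) \<in> U"
      using u U_closed by (auto simp: rep_props(3) coord_U)
    have eq: "\<nu> u = \<nu> (e (coord u)) \<otimes>\<^bsub>Q\<^esub> \<nu> (rep u)"
      using \<nu>_mult[OF k r] coord(2)[OF U_closed[OF u]] by simp
    show ?thesis using r k z(2) \<nu>_one
      by (auto simp: glue_def eq val_Cons val Q.m_assoc)
  qed
  have "act x (a, l) = glue (x \<otimes> z, m)" by (simp add: act_def zm)
  then show ?thesis
    using glue_val[of "x \<otimes> z"] x z subgroup.m_closed[OF U x z(1)]
    by (simp add: peel_val \<nu>_mult Q.m_assoc val)
qed

end

end

lemma act_base:
  assumes "x \<in> carrier K"
  shows "act x (\<one>\<^bsub>M\<^esub>, []) = (coord x, if rep x = \<one> then [] else [c (rep x)])"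
  using assms by (simp add: act_def bare_def peel_bare e_one glue_def)

end

section \<open>Normal forms in an amalgamated product\<close>

locale compatible_subgroups =
  fixes G :: "('a, 'm) monoid_scheme" and H :: "('b, 'n) monoid_scheme"
    and A G' :: "'a set" and B H' :: "'b set" and \<phi> :: "'a \<Rightarrow> 'b"
  assumes G: "group G" and H: "group H"
    and A: "subgroup A G" and B: "subgroup B H"
    and \<phi>: "\<phi> \<in> iso (G\<lparr>carrier := A\<rparr>) (H\<lparr>carrier := B\<rparr>)"
    and G': "subgroup G' G" and H': "subgroup H' H"
    and \<phi>_sub: "\<phi> ` (G' \<inter> A) = H' \<inter> B"
begin

lemma \<phi>_bij: "bij_betw \<phi> A B"
  using \<phi> by (simp add: iso_def)

lemma \<phi>_hom: "\<phi> \<in> hom (G\<lparr>carrier := A\<rparr>) H"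
  using \<phi> subgroup.subset[OF B] by (auto simp: iso_def hom_def)

text \<open>
  \<open>\<phi>\<close> identifies \<open>A'\<close> with \<open>B'\<close>, hence normal forms over \<open>G'\<close> and \<open>H'\<close> have the same admissible
  first components, namely \<open>A'\<close>, whichever factor is acting.
\<close>

lemma \<phi>_mem_iff: "a \<in> A \<Longrightarrow> \<phi> a \<in> H' \<longleftrightarrow> a \<in> G'"
  using \<phi>_sub \<phi>_bij unfolding bij_betw_def by (auto dest: inj_onD)

sublocale left: amalgam_factor G "G\<lparr>carrier := A\<rparr>" "\<lambda>a. a" G' "Inl :: 'a \<Rightarrow> 'a + 'b"
  using G A G' subgroup.subgroup_is_group[OF A G] subgroup.subset[OF A]
  by (auto simp: amalgam_factor_def amalgam_factor_axioms_def hom_def)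

sublocale right: amalgam_factor H "G\<lparr>carrier := A\<rparr>" \<phi> H' "Inr :: 'b \<Rightarrow> 'a + 'b"
  using H H' subgroup.subgroup_is_group[OF A G] \<phi>_hom \<phi>_bij
  by (auto simp: amalgam_factor_def amalgam_factor_axioms_def bij_betw_def)

sublocale big: amalgam G H A \<phi>
  using G H subgroup.subset[OF A] subgroup.subset[OF B] \<phi>_bij
  by (intro amalgam.intro) (auto simp: bij_betw_def)

definition \<phi>' :: "'a \<Rightarrow> 'b" where
  "\<phi>' = restrict \<phi> (G' \<inter> A)"

lemma \<phi>'_apply: "a \<in> G' \<Longrightarrow> a \<in> A \<Longrightarrow> \<phi>' a = \<phi> a"
  by (simp add: \<phi>'_def)

sublocale small: amalgam "G\<lparr>carrier := G'\<rparr>" "H\<lparr>carrier := H'\<rparr>" "G' \<inter> A" \<phi>'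
  using subgroup.subgroup_is_group[OF G' G] subgroup.subgroup_is_group[OF H' H] \<phi>_sub
  by (intro amalgam.intro) (auto simp: \<phi>'_apply)

lemma small_words: "w \<in> small.W \<Longrightarrow> w \<in> big.W"
  using subgroup.subset[OF G'] subgroup.subset[OF H'] by (auto simp: in_lists_conv_set)

definition normal_lists :: "('a + 'b) list set" where
  "normal_lists = {l. successively (\<lambda>s t. isl s \<noteq> isl t) l \<and>
     set l \<subseteq> left.transversal <+> right.transversal}"

lemma left_bare_iff: "left.bare l \<longleftrightarrow> l = [] \<or> \<not> isl (hd l)"
  by (cases l; cases "hd l") (auto simp: left.bare_def)

lemma right_bare_iff: "right.bare l \<longleftrightarrow> l = [] \<or> isl (hd l)"
  by (cases l; cases "hd l") (auto simp: right.bare_def)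

lemma normal_Inl:
  "Inl t # l \<in> normal_lists \<longleftrightarrow> t \<in> left.transversal \<and> left.bare l \<and> l \<in> normal_lists"
  by (cases l) (auto simp: normal_lists_def left_bare_iff)

lemma normal_Inr:
  "Inr t # l \<in> normal_lists \<longleftrightarrow> t \<in> right.transversal \<and> right.bare l \<and> l \<in> normal_lists"
  by (cases l) (auto simp: normal_lists_def right_bare_iff)

definition word_act :: "('a + 'b) list \<Rightarrow> 'a \<times> ('a + 'b) list \<Rightarrow> 'a \<times> ('a + 'b) list" where
  "word_act = foldr (case_sum left.act right.act)"

abbreviation forms where "forms \<equiv> A \<times> normal_lists"

lemma word_act_closed: "w \<in> big.W \<Longrightarrow> \<omega> \<in> forms \<Longrightarrow> word_act w \<omega> \<in> forms"
proof (induction w)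
  case (Cons s w)
  then have "word_act w \<omega> \<in> forms" by simp
  with Cons.prems(1) show ?case
    using left.act_closed[OF normal_Inl, of _ "word_act w \<omega>"]
      right.act_closed[OF normal_Inr, of _ "word_act w \<omega>"]
    by (cases s) (simp_all add: word_act_def Plus_def image_iff)
qed (simp add: word_act_def)

text \<open>
  Each defining relation of the amalgamated product acts trivially, so that words act through
  their classes.
\<close>

lemma word_act_cong:
  "amalg_eq G H A \<phi> u v \<Longrightarrow> \<omega> \<in> forms \<Longrightarrow> word_act u \<omega> = word_act v \<omega>"
proof (induction arbitrary: \<omega> rule: amalg_eq.induct)
  case (append u v u' v')
  have "v' \<in> big.W" using big.amalg_eq_words[OF append.hyps(2)] by (rule conjunct2)
  then have "word_act v' \<omega> \<in> forms" using append.prems by (rule word_act_closed)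
  from append.IH(1)[OF this] append.IH(2)[OF append.prems]
  show ?case by (simp add: word_act_def)
next
  case one_left
  then show ?case using left.act_one[OF normal_Inl, of \<omega>] by (simp add: word_act_def)
next
  case one_right
  then show ?case using right.act_one[OF normal_Inr, of \<omega>] by (simp add: word_act_def)
next
  case (mult_left x y)
  then show ?case using left.act_act[OF normal_Inl, of x y \<omega>] by (simp add: word_act_def)
next
  case (mult_right x y)
  then show ?case using right.act_act[OF normal_Inr, of x y \<omega>] by (simp add: word_act_def)
next
  case (amalg a)
  obtain b l where "\<omega> = (b, l)" by force
  then show ?case
    using amalg left.act_embed[OF normal_Inl, of a b l] right.act_embed[OF normal_Inr, of a b l]
    by (simp add: word_act_def)
next
  case (trans u v w)
  show ?case using trans.IH(1)[OF trans.prems] trans.IH(2)[OF trans.prems] by simp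
qed simp_all

definition normal_form :: "('a + 'b) list \<Rightarrow> 'a \<times> ('a + 'b) list" where
  "normal_form w = word_act w (\<one>\<^bsub>G\<^esub>, [])"

lemma base_in: "(\<one>\<^bsub>G\<^esub>, []) \<in> (G' \<inter> A) \<times> (normal_lists \<inter> small.W)"
  using subgroup.one_closed[OF A] subgroup.one_closed[OF G'] by (simp add: normal_lists_def)

lemma normal_form_cong:
  assumes "u \<in> big.W" "v \<in> big.W" "big.R `` {u} = big.R `` {v}"
  shows "normal_form u = normal_form v"
proof -
  have "amalg_eq G H A \<phi> u v"
    using assms eq_equiv_class_iff[OF big.equiv_R, of u v] by (simp add: amalg_rel_def)
  then show ?thesis
    unfolding normal_form_def using base_in by (intro word_act_cong) auto
qed

lemma left_sub_eq: "{a \<in> carrier (G\<lparr>carrier := A\<rparr>). a \<in> G'} = G' \<inter> A"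
  by auto

lemma right_sub_eq: "{a \<in> carrier (G\<lparr>carrier := A\<rparr>). \<phi> a \<in> H'} = G' \<inter> A"
  using \<phi>_mem_iff by auto

lemma Inl_small: "Inl t \<in> carrier (G\<lparr>carrier := G'\<rparr>) <+> carrier (H\<lparr>carrier := H'\<rparr>) \<longleftrightarrow> t \<in> G'"
  by auto

lemma Inr_small: "Inr t \<in> carrier (G\<lparr>carrier := G'\<rparr>) <+> carrier (H\<lparr>carrier := H'\<rparr>) \<longleftrightarrow> t \<in> H'"
  by auto

lemma normal_form_sub:
  "w \<in> small.W \<Longrightarrow> normal_form w \<in> (G' \<inter> A) \<times> (normal_lists \<inter> small.W)"
proof (induction w)
  case Nil
  then show ?case using base_in by (simp add: normal_form_def word_act_def)
next
  case (Cons s w)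
  have w: "w \<in> small.W" using Cons.prems by simp
  show ?case
  proof (cases s)
    case (Inl x)
    then have "x \<in> G'" using Cons.prems by auto
    then show ?thesis
      using left.act_sub[OF normal_Inl Inl_small, of x "normal_form w", unfolded left_sub_eq] Cons.IH[OF w]
      by (simp add: normal_form_def word_act_def Inl)
  next
    case (Inr x)
    then have "x \<in> H'" using Cons.prems by auto
    then show ?thesis
      using right.act_sub[OF normal_Inr Inr_small, of x "normal_form w", unfolded right_sub_eq] Cons.IH[OF w]
      by (simp add: normal_form_def word_act_def Inr)
  qed
qed

definition form_value :: "'a \<times> ('a + 'b) list \<Rightarrow> ('a + 'b) list set" where
  "form_value \<omega> = small.inl (fst \<omega>) \<otimes>\<^bsub>small.P\<^esub> small.R `` {snd \<omega>}"

lemma class_Cons_Inl: "t \<in> G' \<Longrightarrow> l \<in> small.W \<Longrightarrow>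
    small.R `` {Inl t # l} = small.inl t \<otimes>\<^bsub>small.P\<^esub> small.R `` {l}"
  using small.mult_P[of "[Inl t]" l] by (auto simp: amalg_inl_def)

lemma class_Cons_Inr: "t \<in> H' \<Longrightarrow> l \<in> small.W \<Longrightarrow>
    small.R `` {Inr t # l} = small.inr t \<otimes>\<^bsub>small.P\<^esub> small.R `` {l}"
  using small.mult_P[of "[Inr t]" l] by (auto simp: amalg_inr_def)

text \<open>
  Prefixing a letter multiplies both sides by that letter. In the case of a letter
  of \<open>H'\<close> the first component \<open>a \<in> A'\<close> has to be read as \<open>\<phi> a\<close> in \<open>H'\<close>, by the amalgamation.
\<close>

lemma form_value_normal_form:
  "w \<in> small.W \<Longrightarrow> form_value (normal_form w) = small.R `` {w}"
proof (induction w)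
  case Nil
  interpret small_group: group small.P by (rule small.group_P)
  have "small.inl \<one>\<^bsub>G\<^esub> = \<one>\<^bsub>small.P\<^esub>"
    using hom_one[OF small.inl_hom small.group_G small.group_P] by simp
  moreover have "normal_form [] = (\<one>\<^bsub>G\<^esub>, [])" by (simp add: normal_form_def word_act_def)
  ultimately show ?case
    unfolding form_value_def small.one_P[symmetric] fst_conv snd_conv
    using small_group.l_one[OF small_group.one_closed] by (simp only: fst_conv snd_conv small.one_P[symmetric])
next
  case (Cons s w)
  have w: "w \<in> small.W" using Cons.prems by simp
  obtain a l where al: "normal_form w = (a, l)" by force
  have a: "a \<in> G'" "a \<in> A" and l: "l \<in> normal_lists \<inter> small.W"
    using normal_form_sub[OF w] al by auto
  have inl_inr: "small.inl b = small.inr (\<phi> b)" if "b \<in> G' \<inter> A" for b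
    using small.inl_eq_inr[OF that] that by (simp add: \<phi>'_apply)
  have nf: "normal_form (s # w) \<in> (G' \<inter> A) \<times> (normal_lists \<inter> small.W)"
    using normal_form_sub[OF Cons.prems] .
  show ?case
  proof (cases s)
    case (Inl x)
    then have x: "x \<in> G'" using Cons.prems by auto
    have "form_value (normal_form (s # w)) = small.inl x \<otimes>\<^bsub>small.P\<^esub> form_value (normal_form w)"
      using left.value_act[OF normal_Inl Inl_small small.group_P small.inl_hom small.class_in_P
          class_Cons_Inl x _ _ l, of a] a al
      by (simp add: form_value_def normal_form_def word_act_def Inl)
    then show ?thesis using Cons.IH[OF w] class_Cons_Inl[OF x w] Inl by simp
  next
    case (Inr x)
    then have x: "x \<in> H'" using Cons.prems by auto
    have "form_value (normal_form (s # w)) = small.inr x \<otimes>\<^bsub>small.P\<^esub> form_value (normal_form w)"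
      using right.value_act[OF normal_Inr Inr_small small.group_P small.inr_hom small.class_in_P
          class_Cons_Inr x _ _ l, of a] a al inl_inr \<phi>_mem_iff[of a] nf
      by (auto simp add: form_value_def normal_form_def word_act_def Inr)
    then show ?thesis using Cons.IH[OF w] class_Cons_Inr[OF x w] Inr by simp
  qed
qed

section \<open>The subgroup generated by compatible subgroups\<close>

text \<open>
  Elements of \<open>G' *\<^bsub>\<phi>'\<^esub> H'\<close> can be recovered from normal forms, and normal forms are computed
  in \<open>G *\<^bsub>\<phi>\<^esub> H\<close>.
\<close>

lemma class_eq_reflects:
  assumes "u \<in> small.W" "v \<in> small.W" "big.R `` {u} = big.R `` {v}"
  shows "small.R `` {u} = small.R `` {v}"
proof -
  have "normal_form u = normal_form v"
    using assms small_words by (intro normal_form_cong)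
  then show ?thesis using assms(1,2) form_value_normal_form by metis
qed

abbreviation incl where "incl \<equiv> amalg_lift big.P big.inl big.inr"

lemma inl_hom_sub: "big.inl \<in> hom (G\<lparr>carrier := G'\<rparr>) big.P"
  using hom_in_carrier[OF big.inl_hom] hom_mult[OF big.inl_hom] subgroup.subset[OF G']
  by (intro homI) (simp_all add: subset_iff)

lemma inr_hom_sub: "big.inr \<in> hom (H\<lparr>carrier := H'\<rparr>) big.P"
  using hom_in_carrier[OF big.inr_hom] hom_mult[OF big.inr_hom] subgroup.subset[OF H']
  by (intro homI) (simp_all add: subset_iff)

lemma agree: "a \<in> G' \<inter> A \<Longrightarrow> big.inl a = big.inr (\<phi>' a)"
  using big.inl_eq_inr by (simp add: \<phi>'_apply)

lemmas incl_facts = big.group_P inl_hom_sub inr_hom_sub agree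

text \<open>On classes of words, the natural homomorphism just enlarges the alphabet.\<close>

lemma incl_class:
  assumes "w \<in> small.W"
  shows "incl (small.R `` {w}) = big.R `` {w}"
proof -
  have "w \<in> big.W \<Longrightarrow> word_eval big.P big.inl big.inr w = big.R `` {w}" for w
  proof (induction w)
    case (Cons s w)
    then show ?case
      using big.mult_P[of "[s]" w]
      by (cases s) (auto simp: word_eval_def amalg_inl_def amalg_inr_def)
  qed (simp add: word_eval_def big.one_P)
  then show ?thesis
    using small.lift_class[OF incl_facts assms] small_words[OF assms] by simp
qed

lemma incl_hom: "incl \<in> hom small.P big.P"
  by (rule small.lift_hom[OF incl_facts])

lemma incl_inj: "inj_on incl (carrier small.P)"
proof (rule inj_onI)
  fix X Y assume "X \<in> carrier small.P" "Y \<in> carrier small.P" and eq: "incl X = incl Y"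
  then obtain u v where u: "u \<in> small.W" "X = small.R `` {u}" and v: "v \<in> small.W" "Y = small.R `` {v}"
    by (metis small.carrier_P_cases)
  have "big.R `` {u} = big.R `` {v}"
    using eq unfolding u(2) v(2) incl_class[OF u(1)] incl_class[OF v(1)] .
  then show "X = Y" unfolding u(2) v(2) by (rule class_eq_reflects[OF u(1) v(1)])
qed

abbreviation sub_product where "sub_product \<equiv> generate big.P (big.inl ` G' \<union> big.inr ` H')"

lemma incl_image: "incl ` carrier small.P = sub_product"
proof
  interpret \<theta>: group_hom small.P big.P incl
    using small.group_P big.group_P incl_hom by (simp add: group_hom_def group_hom_axioms_def)
  have "big.inl x \<in> incl ` carrier small.P" if "x \<in> G'" for x
    using small.lift_inl[OF incl_facts, of x] hom_in_carrier[OF small.inl_hom, of x] that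
    by (intro image_eqI[of _ _ "small.inl x"]) simp_all
  moreover have "big.inr x \<in> incl ` carrier small.P" if "x \<in> H'" for x
    using small.lift_inr[OF incl_facts, of x] hom_in_carrier[OF small.inr_hom, of x] that
    by (intro image_eqI[of _ _ "small.inr x"]) simp_all
  ultimately show "sub_product \<subseteq> incl ` carrier small.P"
    by (intro \<theta>.H.generate_subgroup_incl[OF _ \<theta>.img_is_subgroup]) auto
  have "w \<in> small.W \<Longrightarrow> big.R `` {w} \<in> sub_product" for w
  proof (induction w)
    case Nil
    show ?case using generate.one by (metis big.one_P)
  next
    case (Cons s w)
    have s: "[s] \<in> small.W" and w: "w \<in> small.W" using Cons.prems by auto
    have "big.R `` {[s]} \<in> sub_product"
      using s by (cases s) (auto simp: amalg_inl_def amalg_inr_def intro!: generate.incl)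
    then have "big.R `` {[s]} \<otimes>\<^bsub>big.P\<^esub> big.R `` {w} \<in> sub_product"
      using Cons.IH[OF w] by (rule generate.eng)
    then show ?case
      using big.mult_P[OF small_words[OF s] small_words[OF w]] by simp
  qed
  then show "incl ` carrier small.P \<subseteq> sub_product"
    by (metis image_subsetI incl_class small.carrier_P_cases)
qed

lemma sub_product_normal_form:
  assumes "big.R `` {u} \<in> sub_product" "u \<in> big.W"
  shows "normal_form u \<in> (G' \<inter> A) \<times> (normal_lists \<inter> small.W)"
proof -
  obtain X where X: "X \<in> carrier small.P" "incl X = big.R `` {u}"
    using assms(1) unfolding incl_image[symmetric] by (elim imageE) simp
  obtain w where w: "w \<in> small.W" "X = small.R `` {w}"
    using X(1) by (rule small.carrier_P_cases)
  have "big.R `` {w} = big.R `` {u}"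
    using X(2) unfolding w(2) incl_class[OF w(1)] .
  then have "normal_form w = normal_form u"
    by (rule normal_form_cong[OF small_words[OF w(1)] assms(2)])
  then show ?thesis using normal_form_sub[OF w(1)] by simp
qed

text \<open>
  If \<open>x\<close> represents an element of the subgroup, then both factors of
  \<open>x = left.coord x \<otimes> left.rep x\<close>, which can be read off the normal form of \<open>x\<close>, lie in \<open>G'\<close>.
\<close>

lemma inl_in_sub_product:
  assumes "x \<in> carrier G"
  shows "big.inl x \<in> sub_product \<longleftrightarrow> x \<in> G'"
proof
  assume "big.inl x \<in> sub_product"
  then have "normal_form [Inl x] \<in> (G' \<inter> A) \<times> (normal_lists \<inter> small.W)"
    using assms by (intro sub_product_normal_form) (auto simp: amalg_inl_def)
  then have "left.coord x \<in> G'" "left.rep x \<in> G'"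
    using left.act_base[OF assms] subgroup.one_closed[OF G']
    by (auto simp: normal_form_def word_act_def left_bare_iff split: if_splits)
  then show "x \<in> G'"
    using left.coord(2)[OF assms] subgroup.m_closed[OF G'] by metis
qed (auto intro: generate.incl)

lemma inr_in_sub_product:
  assumes "y \<in> carrier H"
  shows "big.inr y \<in> sub_product \<longleftrightarrow> y \<in> H'"
proof
  assume "big.inr y \<in> sub_product"
  then have "normal_form [Inr y] \<in> (G' \<inter> A) \<times> (normal_lists \<inter> small.W)"
    using assms by (intro sub_product_normal_form) (auto simp: amalg_inr_def)
  then have "right.coord y \<in> G' \<inter> A" "right.rep y \<in> H'"
    using right.act_base[OF assms] subgroup.one_closed[OF H']
    by (auto simp: normal_form_def word_act_def right_bare_iff split: if_splits)
  then show "y \<in> H'"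
    using right.coord(2)[OF assms] subgroup.m_closed[OF H'] \<phi>_mem_iff by (metis IntD1 IntD2)
qed (auto intro: generate.incl)

end

theorem lemma3p1:
  fixes G :: "('a, 'm) monoid_scheme" and H :: "('b, 'n) monoid_scheme"
    and A G' A' :: "'a set" and B H' B' :: "'b set"
    and \<phi> \<phi>' :: "'a \<Rightarrow> 'b"
    and \<Gamma> :: "('a + 'b) list set monoid" and \<Gamma>' :: "('a + 'b) list set set"
    and \<iota>G :: "'a \<Rightarrow> ('a + 'b) list set" and \<iota>H :: "'b \<Rightarrow> ('a + 'b) list set"
    and P' :: "('a + 'b) list set monoid"
    and \<theta> :: "('a + 'b) list set \<Rightarrow> ('a + 'b) list set"
  assumes "group G" and "group H"
    and "subgroup A G" and "subgroup B H"
    and "\<phi> \<in> iso (G\<lparr>carrier := A\<rparr>) (H\<lparr>carrier := B\<rparr>)"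
    and "subgroup G' G" and "subgroup H' H"
    and "A' = G' \<inter> A" and "B' = H' \<inter> B" and "\<phi> ` A' = B'"
    and "\<phi>' = restrict \<phi> A'"
    and "\<Gamma> = amalg_product G H A \<phi>"
    and "\<iota>G = amalg_inl G H A \<phi>" and "\<iota>H = amalg_inr G H A \<phi>"
    and "\<Gamma>' = generate \<Gamma> (\<iota>G ` G' \<union> \<iota>H ` H')"
    and "P' = amalg_product (G\<lparr>carrier := G'\<rparr>) (H\<lparr>carrier := H'\<rparr>) A' \<phi>'"
    and "\<theta> = amalg_lift \<Gamma> \<iota>G \<iota>H"
  shows "(\<theta> \<in> hom P' \<Gamma> \<and> inj_on \<theta> (carrier P') \<and> \<theta> ` carrier P' = \<Gamma>')
    \<and> (\<Gamma>' \<inter> \<iota>G ` A = \<iota>G ` A' \<and> \<Gamma>' \<inter> \<iota>H ` B = \<iota>H ` B')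
    \<and> (\<Gamma>' \<inter> \<iota>G ` carrier G = \<iota>G ` G' \<and> \<Gamma>' \<inter> \<iota>H ` carrier H = \<iota>H ` H')"
proof -
  interpret compatible_subgroups G H A G' B H' \<phi>
    using assms(1-10) by (simp add: compatible_subgroups_def)
  have eqs: "\<Gamma>' = sub_product" "\<theta> = incl" "P' = small.P" "\<Gamma> = big.P" "\<iota>G = big.inl" "\<iota>H = big.inr"
    using assms(8-17) by (simp_all add: \<phi>'_def)
  have "\<Gamma>' \<inter> \<iota>G ` X = \<iota>G ` (G' \<inter> X)" if "X \<subseteq> carrier G" for X
    using that inl_in_sub_product unfolding eqs by blast
  moreover have "\<Gamma>' \<inter> \<iota>H ` Y = \<iota>H ` (H' \<inter> Y)" if "Y \<subseteq> carrier H" for Y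
    using that inr_in_sub_product unfolding eqs by blast
  moreover have "G' \<inter> carrier G = G'" "H' \<inter> carrier H = H'"
    using subgroup.subset[OF G'] subgroup.subset[OF H'] by blast+
  ultimately show ?thesis
    using incl_hom incl_inj incl_image subgroup.subset[OF A] subgroup.subset[OF B] assms(8,9)
    by (simp only: eqs)
qed

end
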